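(* Let $c>0$, $\omega\in\mathbb R$ with $\omega\neq0$, and let $[a_{\ell k}]$ be the $s$-nearest-neighbor ring coupling on $N$ nodes. The planar system $$\dot x=\mu x-\omega y-x(x^2+y^2),\qquad \dot y=\omega x+\mu y-y(x^2+y^2)$$ with bifurcation parameter $\mu\in\mathbb R$ undergoes a supercritical Hopf bifurcation at $(x,y)=(0,0)$ when $\mu=0$. Consequently, the full network $$\dot x_\ell=\mu x_\ell-\omega y_\ell-x_\ell(x_\ell^2+y_\ell^2)+c\sum_{k=1}^N a_{\ell k}(x_k-x_\ell),\qquad \dot y_\ell=\omega x_\ell+\mu y_\ell-y_\ell(x_\ell^2+y_\ell^2)+c\sum_{k=1}^N a_{\ell k}(y_k-y_\ell),$$ $\ell=1,\dots,N$, admits a branch of synchronous periodic solutions $$x_1(t)=\cdots=x_N(t)=\sqrt\mu\,\cos(\omega t+\varphi_0),\qquad y_1(t)=\cdots=y_N(t)=\sqrt\mu\,\sin(\omega t+\varphi_0)$$ for $\mu>0$ sufficiently close to $0$, where $\varphi_0\in\mathbb R$ is arbitrary. This branch is orbitally asymptotically stable relative to the synchronous manifold $$\mathcal S:=\{x_1=x_2=\cdots=x_N,\ y_1=y_2=\cdots=y_N\}.$$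
   Context: $s$-nearest-neighbor ring coupling: $a_{\ell k}=1$ if $1\le|\ell-k|_N\le s$ and $a_{\ell k}=0$ otherwise, where $|\ell-k|_N:=\min\{|\ell-k|,N-|\ell-k|\}$; here $1\le s\le N/2$ if $N$ is even and $1\le s\le (N-1)/2$ if $N$ is odd. The manifold $\mathcal S$ is invariant under the full network, and writing $(x_\ell,y_\ell)\equiv(x,y)$ on $\mathcal S$ the induced dynamics is the planar system above. "Orbitally asymptotically stable relative to $\mathcal S$" means that the periodic orbit is orbitally asymptotically stable for the flow restricted to $\mathcal S$, i.e. with respect to perturbations within $\mathcal S$. Supercritical Hopf bifurcation at the origin when $\mu=0$ (in the sense of Hassard--Kazarinoff--Wan): the linearization at the origin has a complex-conjugate pair of eigenvalues $\lambda^\pm(\mu)$ with $\lambda^\pm(0)=\pm\mathrm i\omega$, $\omega\ne0$, and $\operatorname{Re}((\lambda^{\pm})'(0))\neq0$, and the number $p_2:=-\operatorname{Re}(C_1(0))/\operatorname{Re}((\lambda^\pm)'(0))$ is positive, where $C_1(0)$ is the coefficient of $u|u|^2$ in the complex Poincaré normal form $\dot u=\mathrm i\omega u+C_1(0)u|u|^2+\cdots$ at $\mu=0$; thus the bifurcating small-amplitude periodic solutions occur for $\mu>0$. *)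

theory Defs
  imports "HOL-Analysis.Analysis" "HOL-Library.Landau_Symbols"
begin

definition ring_dist :: "nat \<Rightarrow> nat \<Rightarrow> nat \<Rightarrow> int" where
  "ring_dist N l k = min \<bar>int l - int k\<bar> (int N - \<bar>int l - int k\<bar>)"

definition ring_coupling :: "nat \<Rightarrow> nat \<Rightarrow> nat \<Rightarrow> nat \<Rightarrow> real" where
  "ring_coupling N s l k =
     (if 1 \<le> ring_dist N l k \<and> ring_dist N l k \<le> int s then 1 else 0)"

text \<open>A planar state is a vector \<open>p\<close> with \<open>x = p $ 1\<close> and \<open>y = p $ 2\<close>.\<close>

definition planar_field :: "real \<Rightarrow> real \<Rightarrow> real^2 \<Rightarrow> real^2" where
  "planar_field \<omega> \<mu> p = vector
     [\<mu> * p$1 - \<omega> * p$2 - p$1 * ((p$1)\<^sup>2 + (p$2)\<^sup>2),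
      \<omega> * p$1 + \<mu> * p$2 - p$2 * ((p$1)\<^sup>2 + (p$2)\<^sup>2)]"

text \<open>A network state is a family of planar states indexed by the nodes, the elements of a finite
  type: \<open>x\<^sub>l = X $ l $ 1\<close> and \<open>y\<^sub>l = X $ l $ 2\<close>.\<close>

definition network_field ::
    "real \<Rightarrow> real \<Rightarrow> ('n \<Rightarrow> 'n \<Rightarrow> real) \<Rightarrow> real \<Rightarrow> real^2^'n \<Rightarrow> real^2^'n::finite" where
  "network_field \<omega> c a \<mu> X = (\<chi> l. vector
     [\<mu> * X$l$1 - \<omega> * X$l$2 - X$l$1 * ((X$l$1)\<^sup>2 + (X$l$2)\<^sup>2)
        + c * (\<Sum>k\<in>UNIV. a l k * (X$k$1 - X$l$1)),
      \<omega> * X$l$1 + \<mu> * X$l$2 - X$l$2 * ((X$l$1)\<^sup>2 + (X$l$2)\<^sup>2)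
        + c * (\<Sum>k\<in>UNIV. a l k * (X$k$2 - X$l$2))])"

definition sync_manifold :: "(real^2^'n::finite) set" where
  "sync_manifold = {X. \<forall>l k. X$l$1 = X$k$1 \<and> X$l$2 = X$k$2}"

definition solves_on ::
    "('a \<Rightarrow> 'a) \<Rightarrow> (real \<Rightarrow> 'a::real_normed_vector) \<Rightarrow> real set \<Rightarrow> bool" where
  "solves_on f X I \<longleftrightarrow> (\<forall>t\<in>I. (X has_vector_derivative f (X t)) (at t within I))"

definition periodic_solution ::
    "('a \<Rightarrow> 'a) \<Rightarrow> (real \<Rightarrow> 'a::real_normed_vector) \<Rightarrow> bool" where
  "periodic_solution f P \<longleftrightarrow>
     solves_on f P UNIV \<and> (\<exists>T>0. \<forall>t. P (t + T) = P t) \<and> \<not> P constant_on UNIV"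

text \<open>Stability for the flow restricted to \<open>M\<close>: only the initial values are taken in \<open>M\<close>; that
  the solutions starting near the orbit exist for all forward time and remain in \<open>M\<close> is part of
  what is demanded. In particular the condition is not vacuous for lack of solutions.\<close>

definition orbitally_asymptotically_stable_rel ::
    "('a \<Rightarrow> 'a) \<Rightarrow> 'a set \<Rightarrow> (real \<Rightarrow> 'a::real_normed_vector) \<Rightarrow> bool" where
  "orbitally_asymptotically_stable_rel f M P \<longleftrightarrow>
     range P \<subseteq> M \<and>
     (\<forall>\<epsilon>>0. \<exists>\<delta>>0. \<forall>x\<in>M. infdist x (range P) < \<delta> \<longrightarrow>
        (\<exists>X. X 0 = x \<and> solves_on f X {0..}) \<and>
        (\<forall>X. X 0 = x \<and> solves_on f X {0..} \<longrightarrow>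
           (\<forall>t\<ge>0. X t \<in> M \<and> infdist (X t) (range P) < \<epsilon>))) \<and>
     (\<exists>\<delta>>0. \<forall>x\<in>M. infdist x (range P) < \<delta> \<longrightarrow>
        (\<forall>X. X 0 = x \<and> solves_on f X {0..} \<longrightarrow>
           ((\<lambda>t. infdist (X t) (range P)) \<longlongrightarrow> 0) at_top))"

text \<open>For open \<open>U\<close> in a finite-dimensional space this is the usual class \<open>C\<^sup>k\<close>.\<close>

primrec C_k_on ::
    "nat \<Rightarrow> ('a::real_normed_vector \<Rightarrow> 'b::real_normed_vector) \<Rightarrow> 'a set \<Rightarrow> bool" where
  "C_k_on 0 f U \<longleftrightarrow> continuous_on U f"
| "C_k_on (Suc k) f U \<longleftrightarrow>
     (\<forall>x\<in>U. f differentiable (at x)) \<and>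
     (\<forall>v. C_k_on k (\<lambda>x. frechet_derivative f (at x) v) U)"

definition complex_eigenvector :: "real^'n^'n \<Rightarrow> complex \<Rightarrow> complex^'n \<Rightarrow> bool" where
  "complex_eigenvector A z v \<longleftrightarrow>
     v \<noteq> 0 \<and> (\<chi> i j. complex_of_real (A$i$j)) *v v = z *s v"

definition complex_eigenvalue :: "real^'n^'n \<Rightarrow> complex \<Rightarrow> bool" where
  "complex_eigenvalue A z \<longleftrightarrow> (\<exists>v. complex_eigenvector A z v)"

text \<open>The change of variables of Hassard, Kazarinoff and Wan. With \<open>v\<close> an eigenvector of the
  linearization for \<open>\<i>\<omega>\<close>, the plane is parametrized by \<open>z \<mapsto> Re (z v)\<close>, and \<open>z\<close> is in turn
  expressed by a near-identity cubic polynomial in \<open>u\<close> and its conjugate,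
  where the coefficient of the resonant monomial is zero.\<close>

definition nf_polynomial :: "(nat \<Rightarrow> nat \<Rightarrow> complex) \<Rightarrow> complex \<Rightarrow> complex" where
  "nf_polynomial h u =
     u + (\<Sum>(i, j) \<in> {(i, j). 2 \<le> i + j \<and> i + j \<le> 3}. h i j * u ^ i * cnj u ^ j)"

definition nf_transformation ::
    "complex^2 \<Rightarrow> (nat \<Rightarrow> nat \<Rightarrow> complex) \<Rightarrow> complex \<Rightarrow> real^2" where
  "nf_transformation v h u = (\<chi> i. Re (nf_polynomial h u * v$i))"

text \<open>\<open>poincare_coefficient f \<omega> C\<close>: near the origin, the field \<open>f\<close> is conjugate through such a
  change of variables to the complex Poincare normal form
  \<open>u' = \<i>\<omega>u + C u |u|\<^sup>2 + O(|u|\<^sup>4)\<close>, whose right-hand side is \<open>G\<close>. The normalization \<open>v$1 = 1\<close>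
  is always possible in the plane and, together with \<open>h 2 1 = 0\<close>, makes \<open>C\<close> unique.\<close>

definition poincare_coefficient ::
    "(real^2 \<Rightarrow> real^2) \<Rightarrow> real \<Rightarrow> complex \<Rightarrow> bool" where
  "poincare_coefficient f \<omega> C \<longleftrightarrow>
     (\<exists>v h G.
        complex_eigenvector (jacobian f (at 0)) (\<i> * of_real \<omega>) v \<and> v$1 = 1 \<and> h 2 1 = 0 \<and>
        (\<forall>\<^sub>F u in nhds 0.
           frechet_derivative (nf_transformation v h) (at u) (G u) = f (nf_transformation v h u)) \<and>
        (\<lambda>u. norm (G u - (\<i> * of_real \<omega> * u + C * u * of_real ((norm u)\<^sup>2))))
          \<in> O[at 0](\<lambda>u. norm u ^ 4))"

text \<open>Hopf bifurcation of the family \<open>F \<mu>\<close> at the origin when \<open>\<mu> = 0\<close>. The functions \<open>lam\<close> and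
  \<open>cnj \<circ> lam\<close> are the two eigenvalue branches, \<open>D\<close> is the derivative of \<open>lam\<close> at 0,
  and the last condition is \<open>p\<^sub>2 > 0\<close>. The class \<open>C\<^sup>4\<close> is what the cubic normal form requires.\<close>

definition supercritical_Hopf :: "(real \<Rightarrow> real^2 \<Rightarrow> real^2) \<Rightarrow> real \<Rightarrow> bool" where
  "supercritical_Hopf F \<omega> \<longleftrightarrow>
     (\<exists>U. open U \<and> (0, 0) \<in> U \<and> C_k_on 4 (\<lambda>(\<mu>, p). F \<mu> p) U) \<and>
     (\<forall>\<^sub>F \<mu> in nhds 0. F \<mu> 0 = 0) \<and>
     \<omega> \<noteq> 0 \<and>
     (\<exists>lam D C.
        (\<forall>\<^sub>F \<mu> in nhds 0.
           complex_eigenvalue (jacobian (F \<mu>) (at 0)) (lam \<mu>) \<and>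
           complex_eigenvalue (jacobian (F \<mu>) (at 0)) (cnj (lam \<mu>))) \<and>
        lam 0 = \<i> * of_real \<omega> \<and>
        (lam has_vector_derivative D) (at 0) \<and>
        Re D \<noteq> 0 \<and>
        poincare_coefficient (F 0) \<omega> C \<and>
        - Re C / Re D > 0)"

definition sync_solution :: "real \<Rightarrow> real \<Rightarrow> real \<Rightarrow> real \<Rightarrow> real^2^'n::finite" where
  "sync_solution \<omega> \<mu> \<phi> t =
     (\<chi> l. vector [sqrt \<mu> * cos (\<omega> * t + \<phi>), sqrt \<mu> * sin (\<omega> * t + \<phi>)])"

end

theory Submission
  imports Defs
begin

text \<open>With \<open>J\<close> the rotation by a right angle, the planar field is
  \<open>\<mu> p + \<omega> J p - |p|\<^sup>2 p\<close>, which in the complex coordinate \<open>z = x + \<i>y\<close> reads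
  \<open>z' = (\<mu> + \<i>\<omega>) z - z |z|\<^sup>2\<close>. At \<open>\<mu> = 0\<close> this already is a Poincare normal form, with
  coefficient \<open>-1\<close>; the eigenvalues are \<open>\<mu> \<plusminus> \<i>\<omega>\<close>, whose real part has derivative \<open>1\<close>.
  So \<open>p\<^sub>2 = 1\<close>, and the field, being polynomial, is smooth: this is the supercritical Hopf
  bifurcation (\<open>planar_supercritical_Hopf\<close>).

  For \<open>\<mu> > 0\<close> the planar system is integrable: the angle grows at the constant rate \<open>\<omega>\<close>, and
  the radius obeys the Bernoulli equation \<open>\<rho>' = \<mu> \<rho> - \<rho>\<^sup>3\<close>. With \<open>r\<close> the initial radius, its
  solution satisfies \<open>\<rho>(t)\<^sup>2 - \<mu> = (r\<^sup>2 - \<mu>) / d(t)\<close>, where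
  \<open>d(t) = 1 + (r\<^sup>2 / \<mu>) (exp (2\<mu>t) - 1)\<close> is at least \<open>1\<close> for \<open>t \<ge> 0\<close> and tends to infinity
  if \<open>r > 0\<close>. This one formula contains the stability of the circle of radius \<open>\<surd>\<mu>\<close>, from
  \<open>d \<ge> 1\<close>, and its attractivity, from \<open>d \<rightarrow> \<infinity>\<close>.

  On the synchronous manifold the coupling vanishes, so every planar solution yields a solution of
  the network. Stability relative to the manifold concerns all network solutions that start on it,
  so it remains to see that there are no others. The network field is one-sided Lipschitz,
  because the cubic term is monotone and everything else is linear; this gives forward uniqueness
  (\<open>forward_unique_of_one_sided_Lipschitz\<close>). Finally, the diagonal embedding of the plane scales
  norms by \<open>\<surd>N\<close>, so the distance of a synchronous state to the orbit is \<open>\<surd>N\<close> times the deviation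
  of its radius from \<open>\<surd>\<mu>\<close> (\<open>infdist_sync_orbit\<close>), and the planar estimate carries over.\<close>

section \<open>Polynomial maps are smooth\<close>

lemma real_polynomial_function_has_polynomial_derivative:
  assumes "real_polynomial_function p"
  shows "\<exists>p'. (\<forall>v. real_polynomial_function (\<lambda>x. p' x v)) \<and> (\<forall>x. (p has_derivative p' x) (at x))"
  using assms
proof (induction rule: real_polynomial_function.induct)
  case (linear f)
  then show ?case
    by (intro exI[of _ "\<lambda>x. f"])
      (auto intro: bounded_linear_imp_has_derivative real_polynomial_function.intros(2))
next
  case (const c)
  show ?case
    by (intro exI[of _ "\<lambda>x v. 0"]) (auto intro: real_polynomial_function.intros(2))
next
  case (add f g)
  then obtain f' g' where
    "\<forall>v. real_polynomial_function (\<lambda>x. f' x v)" "\<forall>x. (f has_derivative f' x) (at x)"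
    "\<forall>v. real_polynomial_function (\<lambda>x. g' x v)" "\<forall>x. (g has_derivative g' x) (at x)"
    by blast
  then show ?case
    by (intro exI[of _ "\<lambda>x v. f' x v + g' x v"])
      (auto intro: real_polynomial_function.intros(3) has_derivative_add)
next
  case (mult f g)
  then obtain f' g' where
    "\<forall>v. real_polynomial_function (\<lambda>x. f' x v)" "\<forall>x. (f has_derivative f' x) (at x)"
    "\<forall>v. real_polynomial_function (\<lambda>x. g' x v)" "\<forall>x. (g has_derivative g' x) (at x)"
    by blast
  then show ?case using mult.hyps
    by (intro exI[of _ "\<lambda>x v. f x * g' x v + f' x v * g x"])
      (auto intro!: real_polynomial_function.intros(3) real_polynomial_function.intros(4) has_derivative_mult)
qed

text \<open>The directional derivatives of a polynomial map are again polynomial maps, so the recursion that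
  defines \<open>C_k_on\<close> never leaves this class.\<close>

lemma C_k_on_polynomial_function:
  fixes p :: "'a::real_normed_vector \<Rightarrow> 'b::euclidean_space"
  assumes "polynomial_function p"
  shows "C_k_on k p UNIV"
  using assms
proof (induction k arbitrary: p)
  case 0
  then show ?case by (simp add: continuous_on_polymonial_function)
next
  case (Suc k)
  have "\<forall>b\<in>Basis. \<exists>p'. (\<forall>v. real_polynomial_function (\<lambda>x. p' x v)) \<and>
          (\<forall>x. ((\<lambda>x. p x \<bullet> b) has_derivative p' x) (at x))"
    using Suc.prems real_polynomial_function_has_polynomial_derivative
    by (auto simp: polynomial_function_iff_Basis_inner)
  then obtain p' where p':
    "\<And>b v. b \<in> Basis \<Longrightarrow> real_polynomial_function (\<lambda>x. p' b x v)"
    "\<And>b x. b \<in> Basis \<Longrightarrow> ((\<lambda>x. p x \<bullet> b) has_derivative p' b x) (at x)"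
    by metis
  define q where "q x v = (\<Sum>b\<in>Basis. p' b x v *\<^sub>R b)" for x v
  have q_inner: "q x v \<bullet> b = p' b x v" if "b \<in> Basis" for x v b
    using that by (simp add: q_def)
  have deriv: "(p has_derivative q x) (at x)" for x
    by (subst has_derivative_componentwise_within) (simp add: q_inner p'(2))
  have "polynomial_function (\<lambda>x. q x v)" for v
    by (simp add: polynomial_function_iff_Basis_inner q_inner p'(1))
  moreover have "frechet_derivative p (at x) = q x" for x
    using frechet_derivative_at[OF deriv] by simp
  moreover have "p differentiable (at x)" for x
    unfolding differentiable_def using deriv[of x] by (intro exI)
  ultimately show ?case
    using Suc.IH by simp
qed

section \<open>The planar field in vector form\<close>

definition rot90 :: "real^2 \<Rightarrow> real^2" where
  "rot90 p = vector [- p$2, p$1]"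

lemma bounded_linear_rot90: "bounded_linear rot90"
  by (intro linear_conv_bounded_linear[THEN iffD1] linearI)
    (simp_all add: rot90_def vec_eq_iff forall_2 algebra_simps)

lemma rot90_rot90 [simp]: "rot90 (rot90 p) = - p"
  by (simp add: rot90_def vec_eq_iff forall_2)

lemma inner_rot90_self [simp]: "rot90 p \<bullet> p = 0" "p \<bullet> rot90 p = 0"
  by (simp_all add: rot90_def inner_vec_def sum_2 algebra_simps)

lemma norm_rot90 [simp]: "norm (rot90 p) = norm p"
  by (simp add: rot90_def norm_eq_sqrt_inner inner_vec_def sum_2)

text \<open>Unlike the coordinates, the vector form displays the three terms that the estimates
  treat differently: a multiple of the state, a term orthogonal to it, and a radial cubic damping.\<close>

lemma planar_field_eq:
  "planar_field \<omega> \<mu> p = \<mu> *\<^sub>R p + \<omega> *\<^sub>R rot90 p - (p \<bullet> p) *\<^sub>R p"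
  by (simp add: planar_field_def rot90_def vec_eq_iff forall_2 inner_vec_def sum_2
      power2_eq_square algebra_simps)

lemma planar_field_C_k: "C_k_on k (\<lambda>(\<mu>, p). planar_field \<omega> \<mu> p) UNIV"
proof -
  have fst: "polynomial_function (\<lambda>x::real \<times> (real^2). fst x)"
    and snd: "polynomial_function (\<lambda>x::real \<times> (real^2). snd x)"
    and rot: "polynomial_function (\<lambda>x::real \<times> (real^2). rot90 (snd x))"
    by (auto intro!: polynomial_function_bounded_linear bounded_linear_fst bounded_linear_snd
        bounded_linear_compose[OF bounded_linear_rot90])
  have coord: "polynomial_function (\<lambda>x::real \<times> (real^2). snd x $ i)" for i
    by (auto intro!: polynomial_function_bounded_linear bounded_linear_snd
        bounded_linear_compose[OF bounded_linear_vec_nth])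
  have "polynomial_function (\<lambda>x::real \<times> (real^2). snd x \<bullet> snd x)"
    using polynomial_function_add[OF polynomial_function_mult[OF coord[of 1] coord[of 1]]
        polynomial_function_mult[OF coord[of 2] coord[of 2]]]
    by (simp add: inner_vec_def sum_2)
  then have "polynomial_function (\<lambda>x::real \<times> (real^2). fst x *\<^sub>R snd x + \<omega> *\<^sub>R rot90 (snd x)
      - (snd x \<bullet> snd x) *\<^sub>R snd x)"
    by (intro polynomial_function_diff polynomial_function_add polynomial_function_mult
        polynomial_function_cmul fst snd rot)
  then show ?thesis
    by (intro C_k_on_polynomial_function) (simp add: planar_field_eq case_prod_unfold)
qed

lemma jacobian_planar_field_0:
  "jacobian (planar_field \<omega> \<mu>) (at 0) = vector [vector [\<mu>, - \<omega>], vector [\<omega>, \<mu>]]"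
proof -
  have "(planar_field \<omega> \<mu> has_derivative (\<lambda>h. \<mu> *\<^sub>R h + \<omega> *\<^sub>R rot90 h)) (at 0)"
    unfolding planar_field_eq
    by (auto intro!: derivative_eq_intros bounded_linear.has_derivative[OF bounded_linear_rot90])
  then have "frechet_derivative (planar_field \<omega> \<mu>) (at 0) = (\<lambda>h. \<mu> *\<^sub>R h + \<omega> *\<^sub>R rot90 h)"
    using frechet_derivative_at by metis
  then show ?thesis
    by (simp add: jacobian_def matrix_def vec_eq_iff forall_2 rot90_def axis_def)
qed

lemma planar_eigenvectors:
  "complex_eigenvector (jacobian (planar_field \<omega> \<mu>) (at 0)) (Complex \<mu> \<omega>) (vector [1, - \<i>])"
  "complex_eigenvector (jacobian (planar_field \<omega> \<mu>) (at 0)) (Complex \<mu> (- \<omega>)) (vector [1, \<i>])"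
  by (simp_all add: complex_eigenvector_def jacobian_planar_field_0 vec_eq_iff forall_2
      matrix_vector_mult_def sum_2 vector_scalar_mult_def complex_eq_iff)

text \<open>The eigenvector \<open>(1, -\<i>)\<close> identifies \<open>u\<close> with the point \<open>(Re u, Im u)\<close>. Since the field
  at \<open>\<mu> = 0\<close> is \<open>\<i>\<omega>u - u|u|\<^sup>2\<close> in this coordinate, the near-identity change of variables is
  the identity, and the remainder is zero.\<close>

lemma planar_poincare_coefficient: "poincare_coefficient (planar_field \<omega> 0) \<omega> (- 1)"
proof -
  let ?v = "vector [1, - \<i>] :: complex^2"
  let ?h = "\<lambda>(i::nat) (j::nat). 0 :: complex"
  let ?G = "\<lambda>u. \<i> * of_real \<omega> * u + (- 1) * u * of_real ((norm u)\<^sup>2)"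
  have T: "nf_transformation ?v ?h = (\<lambda>u. vector [Re u, Im u])"
    by (auto simp: nf_transformation_def nf_polynomial_def vec_eq_iff forall_2 fun_eq_iff)
  have "linear (\<lambda>u. vector [Re u, Im u] :: real^2)"
    by (intro linearI) (simp_all add: vec_eq_iff forall_2)
  then have "bounded_linear (\<lambda>u. vector [Re u, Im u] :: real^2)"
    by (simp add: linear_conv_bounded_linear)
  then have D: "frechet_derivative (\<lambda>u. vector [Re u, Im u] :: real^2) (at u)
      = (\<lambda>u. vector [Re u, Im u])" for u
    using frechet_derivative_at[OF bounded_linear_imp_has_derivative] by metis
  have "frechet_derivative (nf_transformation ?v ?h) (at u) (?G u)
      = planar_field \<omega> 0 (nf_transformation ?v ?h u)" for u
    unfolding T D planar_field_def
    by (simp add: vec_eq_iff forall_2 cmod_power2)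
  moreover have "complex_eigenvector (jacobian (planar_field \<omega> 0) (at 0)) (\<i> * of_real \<omega>) ?v"
    using planar_eigenvectors(1)[of \<omega> 0] by (simp add: complex_eq_iff Complex_eq)
  ultimately show ?thesis
    unfolding poincare_coefficient_def
    by (intro exI[of _ ?v] exI[of _ ?h] exI[of _ ?G]) simp
qed

lemma planar_supercritical_Hopf:
  assumes "\<omega> \<noteq> 0"
  shows "supercritical_Hopf (planar_field \<omega>) \<omega>"
proof -
  let ?lam = "\<lambda>\<mu>. Complex \<mu> \<omega>"
  have "\<exists>U. open U \<and> (0, 0) \<in> U \<and> C_k_on 4 (\<lambda>(\<mu>, p). planar_field \<omega> \<mu> p) U"
    using planar_field_C_k by blast
  moreover have "planar_field \<omega> \<mu> 0 = 0" for \<mu>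
    using linear_0[OF bounded_linear.linear[OF bounded_linear_rot90]]
    by (simp add: planar_field_eq)
  moreover have "complex_eigenvalue (jacobian (planar_field \<omega> \<mu>) (at 0)) (?lam \<mu>)"
    "complex_eigenvalue (jacobian (planar_field \<omega> \<mu>) (at 0)) (cnj (?lam \<mu>))" for \<mu>
    using planar_eigenvectors unfolding complex_eigenvalue_def complex_cnj by blast+
  moreover have "?lam 0 = \<i> * of_real \<omega>"
    by (simp add: complex_eq_iff)
  moreover have "(?lam has_vector_derivative 1) (at 0)"
    unfolding Complex_eq by (auto intro!: derivative_eq_intros)
  ultimately show ?thesis
    unfolding supercritical_Hopf_def
    using assms planar_poincare_coefficient
    by (intro conjI exI[of _ ?lam] exI[of _ 1] exI[of _ "- 1"]) auto
qed

section \<open>The explicit planar flow\<close>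

text \<open>The substitution \<open>w = 1 / \<rho>\<^sup>2\<close> turns \<open>\<rho>' = \<mu> \<rho> - \<rho>\<^sup>3\<close> into the linear equation
  \<open>w' = 2 - 2 \<mu> w\<close>. Writing its solution as \<open>\<rho>(t) = r g(t)\<close> with \<open>r = \<rho>(0)\<close> gives the factor
  \<open>g\<close> (\<open>flow_gain\<close>), which also makes sense for \<open>r = 0\<close>.\<close>

definition flow_denominator :: "real \<Rightarrow> real \<Rightarrow> real \<Rightarrow> real" where
  "flow_denominator \<mu> r t = 1 + r\<^sup>2 / \<mu> * (exp (2 * \<mu> * t) - 1)"

definition flow_gain :: "real \<Rightarrow> real \<Rightarrow> real \<Rightarrow> real" where
  "flow_gain \<mu> r t = exp (\<mu> * t) / sqrt (flow_denominator \<mu> r t)"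

definition planar_flow :: "real \<Rightarrow> real \<Rightarrow> real^2 \<Rightarrow> real \<Rightarrow> real^2" where
  "planar_flow \<omega> \<mu> p t =
     flow_gain \<mu> (norm p) t *\<^sub>R (cos (\<omega> * t) *\<^sub>R p + sin (\<omega> * t) *\<^sub>R rot90 p)"

lemma flow_denominator_ge_1:
  assumes "\<mu> > 0" "t \<ge> 0"
  shows "flow_denominator \<mu> r t \<ge> 1"
  using assms by (simp add: flow_denominator_def)

lemma flow_gain_has_derivative:
  assumes "\<mu> > 0" and pos: "flow_denominator \<mu> r t > 0"
  shows "(flow_gain \<mu> r has_real_derivative
      \<mu> * flow_gain \<mu> r t - r\<^sup>2 * flow_gain \<mu> r t ^ 3) (at t)"
proof -
  let ?d = "flow_denominator \<mu> r t"
  have d': "(flow_denominator \<mu> r has_real_derivative 2 * r\<^sup>2 * exp (\<mu> * t) ^ 2) (at t)"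
    unfolding flow_denominator_def using assms(1)
    by (auto intro!: derivative_eq_intros simp: exp_double[symmetric] mult.assoc)
  \<comment> \<open>Naming the square root keeps the remaining identity rational in \<open>s\<close> and the exponential.\<close>
  obtain s where s: "s > 0" "?d = s\<^sup>2" "sqrt ?d = s"
    using pos by (metis real_sqrt_gt_zero real_sqrt_pow2 less_imp_le)
  have "(flow_gain \<mu> r has_real_derivative
      (\<mu> * exp (\<mu> * t) * s - exp (\<mu> * t) * (2 * r\<^sup>2 * exp (\<mu> * t) ^ 2 * (inverse s / 2))) / s\<^sup>2) (at t)"
    unfolding flow_gain_def using pos s d'
    by (auto intro!: derivative_eq_intros DERIV_real_sqrt simp: power2_eq_square)
  also have "(\<mu> * exp (\<mu> * t) * s - exp (\<mu> * t) * (2 * r\<^sup>2 * exp (\<mu> * t) ^ 2 * (inverse s / 2))) / s\<^sup>2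
      = \<mu> * flow_gain \<mu> r t - r\<^sup>2 * flow_gain \<mu> r t ^ 3"
    unfolding flow_gain_def s(3) using s(1)
    by (simp add: field_simps power2_eq_square power3_eq_cube)
  finally show ?thesis .
qed

lemma norm_rotation:
  "norm (cos a *\<^sub>R p + sin a *\<^sub>R rot90 p) = norm p"
proof -
  have "(cos a *\<^sub>R p + sin a *\<^sub>R rot90 p) \<bullet> (cos a *\<^sub>R p + sin a *\<^sub>R rot90 p)
      = (cos a)\<^sup>2 * (norm p)\<^sup>2 + (sin a)\<^sup>2 * (norm (rot90 p))\<^sup>2"
    by (simp add: inner_add inner_scaleR_left dot_square_norm[of p] dot_square_norm[of "rot90 p"]
        power2_eq_square)
  also have "\<dots> = p \<bullet> p"
    by (simp add: distrib_right[symmetric] power2_norm_eq_inner)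
  finally show ?thesis
    by (simp add: norm_eq_sqrt_inner)
qed

lemma norm_planar_flow: "norm (planar_flow \<omega> \<mu> p t) = \<bar>flow_gain \<mu> (norm p) t\<bar> * norm p"
  by (simp add: planar_flow_def norm_rotation)

lemma planar_flow_0: "planar_flow \<omega> \<mu> p 0 = p"
  by (simp add: planar_flow_def flow_gain_def flow_denominator_def)

lemma planar_flow_has_derivative:
  assumes "\<mu> > 0" "flow_denominator \<mu> (norm p) t > 0"
  shows "(planar_flow \<omega> \<mu> p has_vector_derivative planar_field \<omega> \<mu> (planar_flow \<omega> \<mu> p t)) (at t)"
proof -
  let ?g = "flow_gain \<mu> (norm p) t" and ?c = "cos (\<omega> * t)" and ?s = "sin (\<omega> * t)"
  interpret J: bounded_linear rot90 by (rule bounded_linear_rot90)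
  have sq: "planar_flow \<omega> \<mu> p t \<bullet> planar_flow \<omega> \<mu> p t = ?g\<^sup>2 * (norm p)\<^sup>2"
    by (simp add: power2_norm_eq_inner[symmetric] norm_planar_flow power_mult_distrib)
  have "(planar_flow \<omega> \<mu> p has_vector_derivative
      ?g *\<^sub>R ((- ?s * \<omega>) *\<^sub>R p + (?c * \<omega>) *\<^sub>R rot90 p)
      + (\<mu> * ?g - (norm p)\<^sup>2 * ?g ^ 3) *\<^sub>R (?c *\<^sub>R p + ?s *\<^sub>R rot90 p)) (at t)"
    unfolding planar_flow_def
    by (rule has_vector_derivative_scaleR[OF flow_gain_has_derivative[OF assms]])
      (auto intro!: derivative_eq_intros)
  also have "?g *\<^sub>R ((- ?s * \<omega>) *\<^sub>R p + (?c * \<omega>) *\<^sub>R rot90 p)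
      + (\<mu> * ?g - (norm p)\<^sup>2 * ?g ^ 3) *\<^sub>R (?c *\<^sub>R p + ?s *\<^sub>R rot90 p)
      = planar_field \<omega> \<mu> (planar_flow \<omega> \<mu> p t)"
    unfolding planar_field_eq sq unfolding planar_flow_def
    by (simp add: J.add J.scaleR algebra_simps power2_eq_square power3_eq_cube)
  finally show ?thesis .
qed

text \<open>The squared radius deviates from \<open>\<mu>\<close> by exactly \<open>(r\<^sup>2 - \<mu>) / d\<close>; factoring the difference of
  squares and discarding the radius from the factor \<open>\<rho> + \<surd>\<mu>\<close> bounds the deviation of the radius
  itself.\<close>

lemma flow_radius_deviation:
  assumes "\<mu> > 0" "t \<ge> 0" "r \<ge> 0"
  shows "\<bar>\<bar>flow_gain \<mu> r t\<bar> * r - sqrt \<mu>\<bar> \<le> \<bar>r\<^sup>2 - \<mu>\<bar> / sqrt \<mu> / flow_denominator \<mu> r t"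
proof -
  define d where "d = flow_denominator \<mu> r t"
  define \<rho> where "\<rho> = \<bar>flow_gain \<mu> r t\<bar> * r"
  have d: "d \<ge> 1" unfolding d_def by (rule flow_denominator_ge_1[OF assms(1,2)])
  have "\<rho> \<ge> 0" using assms by (simp add: \<rho>_def)
  have "\<rho>\<^sup>2 = exp (2 * \<mu> * t) * r\<^sup>2 / d"
    using d by (simp add: \<rho>_def flow_gain_def d_def[symmetric] power_mult_distrib power_divide
        exp_double[symmetric] mult.assoc)
  then have "\<rho>\<^sup>2 - \<mu> = (exp (2 * \<mu> * t) * r\<^sup>2 - \<mu> * d) / d"
    using d by (simp add: field_simps)
  also have "exp (2 * \<mu> * t) * r\<^sup>2 - \<mu> * d = r\<^sup>2 - \<mu>"
    using assms(1) by (simp add: d_def flow_denominator_def field_simps)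
  finally have sq: "\<rho>\<^sup>2 - \<mu> = (r\<^sup>2 - \<mu>) / d" .
  have "\<bar>\<rho> - sqrt \<mu>\<bar> * sqrt \<mu> \<le> \<bar>\<rho> - sqrt \<mu>\<bar> * (\<rho> + sqrt \<mu>)"
    using \<open>\<rho> \<ge> 0\<close> by (intro mult_left_mono) auto
  also have "\<dots> = \<bar>(\<rho> - sqrt \<mu>) * (\<rho> + sqrt \<mu>)\<bar>"
    using \<open>\<rho> \<ge> 0\<close> assms(1) by (simp add: abs_mult)
  also have "(\<rho> - sqrt \<mu>) * (\<rho> + sqrt \<mu>) = (r\<^sup>2 - \<mu>) / d"
    using sq assms(1) by (simp add: algebra_simps power2_eq_square)
  finally show ?thesis
    using d assms(1) unfolding \<rho>_def[symmetric] d_def[symmetric]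
    by (simp add: field_simps abs_divide)
qed

lemma flow_denominator_at_top:
  assumes "\<mu> > 0" "r > 0"
  shows "filterlim (flow_denominator \<mu> r) at_top at_top"
proof -
  have "filterlim (\<lambda>t. 2 * \<mu> * t) at_top at_top"
    using assms by (intro filterlim_tendsto_pos_mult_at_top[OF tendsto_const _ filterlim_ident]) auto
  then have "filterlim (\<lambda>t. - 1 + exp (2 * \<mu> * t)) at_top at_top"
    by (intro filterlim_tendsto_add_at_top[OF tendsto_const] filterlim_compose[OF exp_at_top])
  then have "filterlim (\<lambda>t. r\<^sup>2 / \<mu> * (- 1 + exp (2 * \<mu> * t))) at_top at_top"
    using assms by (intro filterlim_tendsto_pos_mult_at_top[OF tendsto_const]) auto
  then show ?thesis
    unfolding flow_denominator_def
    by (intro filterlim_tendsto_add_at_top[OF tendsto_const]) simp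
qed

section \<open>Forward uniqueness for one-sided Lipschitz fields\<close>

text \<open>The weighted squared distance \<open>exp (-2Lt) |X - Y|\<^sup>2\<close> of two solutions does not increase. A bound
  from one side suffices for this, and a cubic field, which is not globally Lipschitz, can satisfy
  it on the whole space.\<close>

lemma forward_unique_of_one_sided_Lipschitz:
  fixes f :: "'a::real_inner \<Rightarrow> 'a"
  assumes L: "\<And>x y. (f x - f y) \<bullet> (x - y) \<le> L * (norm (x - y))\<^sup>2"
    and X: "solves_on f X {0..}" and Y: "solves_on f Y {0..}"
    and "X 0 = Y 0" "t \<ge> 0"
  shows "X t = Y t"
proof -
  define V where "V t = exp (- 2 * L * t) * ((X t - Y t) \<bullet> (X t - Y t))" for t
  define V' where "V' t = exp (- 2 * L * t) *
      (2 * ((f (X t) - f (Y t)) \<bullet> (X t - Y t)) - 2 * L * (norm (X t - Y t))\<^sup>2)" for t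
  have V: "(V has_real_derivative V' t) (at t within {0..})" if "t \<ge> 0" for t
  proof -
    have "((\<lambda>t. X t - Y t) has_vector_derivative f (X t) - f (Y t)) (at t within {0..})"
      using X Y that by (intro has_vector_derivative_diff) (auto simp: solves_on_def)
    then have D: "((\<lambda>t. X t - Y t) has_derivative (\<lambda>h. h *\<^sub>R (f (X t) - f (Y t)))) (at t within {0..})"
      by (simp add: has_vector_derivative_def)
    have "((\<lambda>t. (X t - Y t) \<bullet> (X t - Y t)) has_real_derivative
        2 * ((f (X t) - f (Y t)) \<bullet> (X t - Y t))) (at t within {0..})"
      unfolding has_field_derivative_def
      by (rule has_derivative_eq_rhs[OF has_derivative_inner[OF D D]])
        (auto simp: fun_eq_iff inner_commute)
    moreover have "((\<lambda>t. exp (- 2 * L * t)) has_real_derivative - 2 * L * exp (- 2 * L * t))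
        (at t within {0..})"
      by (auto intro!: derivative_eq_intros)
    ultimately show ?thesis
      unfolding V_def V'_def
      by - (rule DERIV_cong[OF DERIV_mult], assumption, assumption,
        simp add: power2_norm_eq_inner right_diff_distrib mult_ac)
  qed
  have "V' t \<le> 0" for t
    using L[of "X t" "Y t"] by (auto simp: V'_def mult_le_0_iff)
  \<comment> \<open>Only at interior times is the one-sided derivative on the half-line a two-sided one.\<close>
  moreover have "(V has_real_derivative V' t) (at t)" if "t > 0" for t
    using V[of t] that at_within_interior[of t "{0::real..}"] by (simp add: interior_real_atLeast)
  moreover have "continuous_on {0..t} V"
    by (rule continuous_on_subset[of "{0..}"])
      (auto intro!: DERIV_continuous_on V)
  ultimately have "V t \<le> V 0"
    using \<open>t \<ge> 0\<close> by (intro DERIV_nonpos_imp_decreasing_open[of 0 t V]) auto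
  then have "(X t - Y t) \<bullet> (X t - Y t) \<le> 0"
    using \<open>X 0 = Y 0\<close> by (simp add: V_def mult_le_0_iff)
  then show ?thesis
    by (metis eq_iff_diff_eq_0 inner_gt_zero_iff linorder_not_le)
qed

section \<open>The network and its synchronous manifold\<close>

definition coupling_operator :: "('n \<Rightarrow> 'n \<Rightarrow> real) \<Rightarrow> real^2^'n \<Rightarrow> real^2^'n::finite" where
  "coupling_operator a X = (\<chi> l. \<Sum>k\<in>UNIV. a l k *\<^sub>R (X$k - X$l))"

lemma network_field_eq:
  "network_field \<omega> c a \<mu> X = (\<chi> l. planar_field \<omega> \<mu> (X$l)) + c *\<^sub>R coupling_operator a X"
  by (simp add: network_field_def planar_field_def coupling_operator_def vec_eq_iff forall_2
      sum_component)

lemma bounded_linear_coupling_operator: "bounded_linear (coupling_operator a)"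
  by (intro linear_conv_bounded_linear[THEN iffD1] linearI)
    (simp_all add: coupling_operator_def vec_eq_iff sum.distrib[symmetric] sum_distrib_left
      algebra_simps)

text \<open>The field \<open>|x|\<^sup>2 x\<close> is the gradient of the convex function \<open>|x|\<^sup>4 / 4\<close>, hence monotone.\<close>

lemma cubic_monotone:
  fixes x y :: "'a::real_inner"
  shows "((x \<bullet> x) *\<^sub>R x - (y \<bullet> y) *\<^sub>R y) \<bullet> (x - y) \<ge> 0"
proof -
  \<comment> \<open>Twice the left-hand side is a sum of two squares with nonnegative weights.\<close>
  have "2 * (((x \<bullet> x) *\<^sub>R x - (y \<bullet> y) *\<^sub>R y) \<bullet> (x - y))
      = (x \<bullet> x - y \<bullet> y)\<^sup>2 + (x \<bullet> x + y \<bullet> y) * ((x - y) \<bullet> (x - y))"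
    by (simp add: inner_diff inner_commute power2_eq_square algebra_simps)
  also have "\<dots> \<ge> 0" by simp
  finally show ?thesis by simp
qed

lemma planar_field_one_sided_Lipschitz:
  "(planar_field \<omega> \<mu> x - planar_field \<omega> \<mu> y) \<bullet> (x - y) \<le> \<mu> * (norm (x - y))\<^sup>2"
proof -
  have "planar_field \<omega> \<mu> x - planar_field \<omega> \<mu> y
      = \<mu> *\<^sub>R (x - y) + \<omega> *\<^sub>R rot90 (x - y) - ((x \<bullet> x) *\<^sub>R x - (y \<bullet> y) *\<^sub>R y)"
    by (simp add: planar_field_eq linear_diff[OF bounded_linear.linear[OF bounded_linear_rot90]] algebra_simps)
  then have "(planar_field \<omega> \<mu> x - planar_field \<omega> \<mu> y) \<bullet> (x - y)
      = \<mu> * (norm (x - y))\<^sup>2 - ((x \<bullet> x) *\<^sub>R x - (y \<bullet> y) *\<^sub>R y) \<bullet> (x - y)"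
    by (simp only: inner_add_left inner_diff_left[of _ "(x \<bullet> x) *\<^sub>R x - (y \<bullet> y) *\<^sub>R y"]
        inner_scaleR_left inner_rot90_self power2_norm_eq_inner)
  then show ?thesis using cubic_monotone[of x y] by linarith
qed

text \<open>The uncoupled part contributes the planar constant \<open>\<mu>\<close> at every node; the coupling is linear
  on a finite-dimensional space and contributes at most its operator bound.\<close>

lemma network_field_one_sided_Lipschitz:
  obtains L where "\<And>X Y. (network_field \<omega> c a \<mu> X - network_field \<omega> c a \<mu> Y) \<bullet> (X - Y)
    \<le> L * (norm (X - Y))\<^sup>2"
proof -
  interpret K: bounded_linear "coupling_operator a" by (rule bounded_linear_coupling_operator)
  obtain B where B: "\<And>X. norm (coupling_operator a X) \<le> norm X * B"
    using K.bounded by blast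
  have "(network_field \<omega> c a \<mu> X - network_field \<omega> c a \<mu> Y) \<bullet> (X - Y)
      \<le> (\<mu> + \<bar>c\<bar> * B) * (norm (X - Y))\<^sup>2" for X Y
  proof -
    have "((\<chi> l. planar_field \<omega> \<mu> (X$l)) - (\<chi> l. planar_field \<omega> \<mu> (Y$l))) \<bullet> (X - Y)
        \<le> (\<Sum>l\<in>UNIV. \<mu> * (norm (X$l - Y$l))\<^sup>2)"
      by (simp add: inner_vec_def[where 'b='a])
        (intro sum_mono planar_field_one_sided_Lipschitz)
    also have "\<dots> = \<mu> * (norm (X - Y))\<^sup>2"
      by (simp add: sum_distrib_left power2_norm_eq_inner inner_vec_def[where 'b='a])
    finally have 1: "((\<chi> l. planar_field \<omega> \<mu> (X$l)) - (\<chi> l. planar_field \<omega> \<mu> (Y$l))) \<bullet> (X - Y)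
        \<le> \<mu> * (norm (X - Y))\<^sup>2" .
    have "c * (coupling_operator a (X - Y) \<bullet> (X - Y))
        \<le> \<bar>c\<bar> * (norm (coupling_operator a (X - Y)) * norm (X - Y))"
      by (rule order_trans[OF abs_ge_self])
        (simp add: abs_mult mult_left_mono Cauchy_Schwarz_ineq2)
    also have "\<dots> \<le> \<bar>c\<bar> * ((norm (X - Y) * B) * norm (X - Y))"
      by (intro mult_left_mono mult_right_mono B) auto
    finally have 2: "c * (coupling_operator a (X - Y) \<bullet> (X - Y)) \<le> \<bar>c\<bar> * B * (norm (X - Y))\<^sup>2"
      by (simp add: power2_eq_square algebra_simps)
    have "network_field \<omega> c a \<mu> X - network_field \<omega> c a \<mu> Y
        = ((\<chi> l. planar_field \<omega> \<mu> (X$l)) - (\<chi> l. planar_field \<omega> \<mu> (Y$l)))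
          + c *\<^sub>R coupling_operator a (X - Y)"
      by (simp add: network_field_eq K.diff algebra_simps)
    then show ?thesis
      using 1 2 by (simp add: inner_add_left distrib_right)
  qed
  then show thesis by (rule that)
qed

definition sync_embedding :: "real^2 \<Rightarrow> real^2^'n::finite" where
  "sync_embedding p = (\<chi> l. p)"

lemma bounded_linear_sync_embedding: "bounded_linear sync_embedding"
  by (intro linear_conv_bounded_linear[THEN iffD1] linearI)
    (simp_all add: sync_embedding_def vec_eq_iff)

lemma sync_manifold_eq_range: "sync_manifold = range sync_embedding"
proof (intro equalityI subsetI)
  fix X :: "real^2^'n" assume "X \<in> sync_manifold"
  then have "X = sync_embedding (X $ undefined)"
    by (simp add: sync_manifold_def sync_embedding_def vec_eq_iff forall_2)
  then show "X \<in> range sync_embedding" by blast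
qed (auto simp: sync_manifold_def sync_embedding_def)

lemma network_field_sync_embedding:
  "network_field \<omega> c a \<mu> (sync_embedding p) = sync_embedding (planar_field \<omega> \<mu> p)"
  by (simp add: network_field_eq coupling_operator_def sync_embedding_def vec_eq_iff)

lemma norm_sync_embedding:
  "norm (sync_embedding p :: real^2^'n::finite) = sqrt (real CARD('n)) * norm p"
  by (simp add: norm_eq_sqrt_inner inner_vec_def[where 'b='n] sync_embedding_def real_sqrt_mult)

lemma sync_embedding_flow_solves:
  assumes "\<mu> > 0" "\<And>t. t \<in> I \<Longrightarrow> flow_denominator \<mu> (norm p) t > 0"
  shows "solves_on (network_field \<omega> c a \<mu>) (\<lambda>t. sync_embedding (planar_flow \<omega> \<mu> p t)) I"
  unfolding solves_on_def network_field_sync_embedding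
  using assms
  by (auto intro!: bounded_linear.has_vector_derivative[OF bounded_linear_sync_embedding]
      has_vector_derivative_at_within[OF planar_flow_has_derivative])

text \<open>This makes the synchronous manifold invariant and reduces every statement about network solutions
  starting on it to the explicit planar flow.\<close>

lemma solution_from_sync_embedding:
  assumes "\<mu> > 0" "solves_on (network_field \<omega> c a \<mu>) X {0..}" "X 0 = sync_embedding p" "t \<ge> 0"
  shows "X t = sync_embedding (planar_flow \<omega> \<mu> p t)"
proof -
  obtain L where L: "\<And>X Y. (network_field \<omega> c a \<mu> X - network_field \<omega> c a \<mu> Y) \<bullet> (X - Y)
      \<le> L * (norm (X - Y))\<^sup>2"
    using network_field_one_sided_Lipschitz[of \<omega> c a \<mu>] by blast
  have "solves_on (network_field \<omega> c a \<mu>) (\<lambda>t. sync_embedding (planar_flow \<omega> \<mu> p t)) {0..}"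
    using flow_denominator_ge_1 assms(1)
    by (intro sync_embedding_flow_solves) (auto intro: less_le_trans[OF zero_less_one])
  then show ?thesis
    using forward_unique_of_one_sided_Lipschitz[OF L assms(2)] assms(3,4)
    by (simp add: planar_flow_0)
qed

section \<open>The synchronous periodic orbit\<close>

definition circle_point :: "real \<Rightarrow> real \<Rightarrow> real^2" where
  "circle_point r \<theta> = vector [r * cos \<theta>, r * sin \<theta>]"

lemma norm_circle_point: "r \<ge> 0 \<Longrightarrow> norm (circle_point r \<theta>) = r"
  by (simp add: circle_point_def norm_eq_sqrt_inner inner_vec_def sum_2 power_mult_distrib
      power2_eq_square[symmetric] distrib_left[symmetric] real_sqrt_abs)

lemma polar_form:
  obtains \<theta> where "p = circle_point (norm p) \<theta>"
proof (cases "p = 0")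
  case True
  then show thesis by (intro that[of 0]) (simp add: circle_point_def vec_eq_iff forall_2)
next
  case False
  have "(p$1)\<^sup>2 + (p$2)\<^sup>2 = (norm p)\<^sup>2"
    unfolding power2_norm_eq_inner by (simp add: inner_vec_def sum_2 power2_eq_square)
  then have "(p$1 / norm p)\<^sup>2 + (p$2 / norm p)\<^sup>2 = 1"
    using False by (simp add: power_divide add_divide_distrib[symmetric])
  then obtain \<theta> where "p$1 / norm p = cos \<theta>" "p$2 / norm p = sin \<theta>"
    using sincos_total_2pi by metis
  then have "p$1 = norm p * cos \<theta>" "p$2 = norm p * sin \<theta>"
    using False by (metis nonzero_mult_div_cancel_left norm_eq_zero times_divide_eq_right)+
  then show thesis
    by (intro that[of \<theta>]) (simp only: circle_point_def vec_eq_iff forall_2 vector_2 simp_thms)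
qed

lemma sync_solution_eq_circle:
  "sync_solution \<omega> \<mu> \<phi> t = sync_embedding (circle_point (sqrt \<mu>) (\<omega> * t + \<phi>))"
  by (simp add: sync_solution_def sync_embedding_def circle_point_def)

text \<open>On the circle of radius \<open>\<surd>\<mu>\<close> the radial factor is constantly \<open>1\<close>, also for negative times.\<close>

lemma sync_solution_eq_flow:
  assumes "\<mu> > 0"
  shows "sync_solution \<omega> \<mu> \<phi> = (\<lambda>t. sync_embedding (planar_flow \<omega> \<mu> (circle_point (sqrt \<mu>) \<phi>) t))"
proof
  fix t
  have "flow_gain \<mu> (sqrt \<mu>) t = 1"
    using assms
    by (simp add: flow_gain_def flow_denominator_def mult.assoc exp_double)
  then have "flow_gain \<mu> (norm (circle_point (sqrt \<mu>) \<phi>)) t = 1"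
    using assms by (simp add: norm_circle_point)
  then show "sync_solution \<omega> \<mu> \<phi> t
      = sync_embedding (planar_flow \<omega> \<mu> (circle_point (sqrt \<mu>) \<phi>) t)"
    unfolding sync_solution_eq_circle planar_flow_def
    by (simp add: circle_point_def rot90_def
        sync_embedding_def vec_eq_iff forall_2 cos_add sin_add algebra_simps)
qed

lemma sync_solution_periodic:
  assumes "\<mu> > 0" "\<omega> \<noteq> 0"
  shows "periodic_solution (network_field \<omega> c a \<mu>) (sync_solution \<omega> \<mu> \<phi> :: real \<Rightarrow> real^2^'n::finite)"
proof -
  have "solves_on (network_field \<omega> c a \<mu>) (sync_solution \<omega> \<mu> \<phi> :: real \<Rightarrow> real^2^'n) UNIV"
    unfolding sync_solution_eq_flow[OF assms(1)]
    using assms by (intro sync_embedding_flow_solves) (auto simp: norm_circle_point flow_denominator_def)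
  moreover have "(sync_solution \<omega> \<mu> \<phi> (t + 2 * pi / \<bar>\<omega>\<bar>) :: real^2^'n) = sync_solution \<omega> \<mu> \<phi> t" for t
  proof -
    have "\<omega> * (t + 2 * pi / \<bar>\<omega>\<bar>) + \<phi> = (\<omega> * t + \<phi>) + sgn \<omega> * (2 * pi)"
      using assms(2) by (auto simp: sgn_if field_simps abs_if)
    moreover have "cos (x + sgn \<omega> * (2 * pi)) = cos x" "sin (x + sgn \<omega> * (2 * pi)) = sin x" for x
      using assms(2) by (auto simp: sgn_if cos_diff sin_diff)
    ultimately show ?thesis by (simp only: sync_solution_def)
  qed
  moreover have "\<not> (sync_solution \<omega> \<mu> \<phi> :: real \<Rightarrow> real^2^'n) constant_on UNIV"
  proof
    assume "(sync_solution \<omega> \<mu> \<phi> :: real \<Rightarrow> real^2^'n) constant_on UNIV"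
    \<comment> \<open>These are the times at which the phase is \<open>0\<close> and \<open>pi\<close>, at opposite points of the circle.\<close>
    then have "(sync_solution \<omega> \<mu> \<phi> (- \<phi> / \<omega>) :: real^2^'n) = sync_solution \<omega> \<mu> \<phi> ((pi - \<phi>) / \<omega>)"
      unfolding constant_on_def by fastforce
    then have "sqrt \<mu> * cos 0 = sqrt \<mu> * cos pi"
      using assms(2) by (simp add: sync_solution_def vec_eq_iff forall_2)
    then show False using assms(1) by simp
  qed
  ultimately show ?thesis
    unfolding periodic_solution_def using assms(2)
    by (intro conjI exI[of _ "2 * pi / \<bar>\<omega>\<bar>"]) auto
qed

text \<open>Since \<open>\<omega> \<noteq> 0\<close>, the orbit is the whole circle, so it contains the point with the same angle
  as \<open>p\<close>, which is the nearest one by the reverse triangle inequality.\<close>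

lemma infdist_sync_orbit:
  assumes "\<omega> \<noteq> 0" "\<mu> > 0"
  shows "infdist (sync_embedding p) (range (sync_solution \<omega> \<mu> \<phi> :: real \<Rightarrow> real^2^'n::finite))
    = sqrt (real CARD('n)) * \<bar>norm p - sqrt \<mu>\<bar>"
    (is "infdist _ ?O = _")
proof (rule antisym)
  interpret E: bounded_linear "sync_embedding :: real^2 \<Rightarrow> real^2^'n"
    by (rule bounded_linear_sync_embedding)
  have dist: "dist (sync_embedding p :: real^2^'n) (sync_embedding q)
      = sqrt (real CARD('n)) * norm (p - q)" for p q
    by (simp add: dist_norm E.diff[symmetric] norm_sync_embedding)
  obtain \<theta> where \<theta>: "p = circle_point (norm p) \<theta>" by (rule polar_form)
  have "sync_solution \<omega> \<mu> \<phi> ((\<theta> - \<phi>) / \<omega>) = sync_embedding (circle_point (sqrt \<mu>) \<theta>)"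
    using assms(1) by (simp add: sync_solution_eq_circle)
  then have "infdist (sync_embedding p) ?O
      \<le> dist (sync_embedding p :: real^2^'n) (sync_embedding (circle_point (sqrt \<mu>) \<theta>))"
    by (metis infdist_le rangeI)
  also have "p - circle_point (sqrt \<mu>) \<theta> = (norm p - sqrt \<mu>) *\<^sub>R circle_point 1 \<theta>"
    by (subst \<theta>) (simp add: circle_point_def vec_eq_iff forall_2 algebra_simps)
  then have "dist (sync_embedding p :: real^2^'n) (sync_embedding (circle_point (sqrt \<mu>) \<theta>))
      = sqrt (real CARD('n)) * \<bar>norm p - sqrt \<mu>\<bar>"
    by (simp add: dist norm_circle_point)
  finally show "infdist (sync_embedding p) ?O \<le> sqrt (real CARD('n)) * \<bar>norm p - sqrt \<mu>\<bar>" .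
  have "sqrt (real CARD('n)) * \<bar>norm p - sqrt \<mu>\<bar> \<le> dist (sync_embedding p) y" if y: "y \<in> ?O" for y
  proof -
    obtain t where t: "y = sync_embedding (circle_point (sqrt \<mu>) (\<omega> * t + \<phi>))"
      using y by (auto simp: sync_solution_eq_circle)
    have "\<bar>norm p - sqrt \<mu>\<bar> \<le> norm (p - circle_point (sqrt \<mu>) (\<omega> * t + \<phi>))"
      using norm_triangle_ineq3[of p "circle_point (sqrt \<mu>) (\<omega> * t + \<phi>)"] assms(2)
      by (simp add: norm_circle_point)
    then show ?thesis unfolding t dist by (intro mult_left_mono) auto
  qed
  then show "sqrt (real CARD('n)) * \<bar>norm p - sqrt \<mu>\<bar> \<le> infdist (sync_embedding p) ?O"
    by (subst infdist_notempty) (auto intro!: cINF_greatest)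
qed

text \<open>Within distance \<open>\<surd>N \<surd>\<mu>\<close> of the orbit the initial radius lies strictly between \<open>0\<close> and
  \<open>2\<surd>\<mu>\<close>. The upper bound gives \<open>|r\<^sup>2 - \<mu>| \<le> 3\<surd>\<mu> |r - \<surd>\<mu>|\<close>, so distances to the orbit grow at
  most by the factor \<open>3\<close>; the lower bound excludes the equilibrium at the origin, which is what
  convergence requires.\<close>

lemma sync_solution_stable:
  assumes "\<mu> > 0" "\<omega> \<noteq> 0"
  shows "orbitally_asymptotically_stable_rel (network_field \<omega> c a \<mu>) sync_manifold
    (sync_solution \<omega> \<mu> \<phi> :: real \<Rightarrow> real^2^'n::finite)"
proof -
  let ?f = "network_field \<omega> c a \<mu> :: real^2^'n \<Rightarrow> real^2^'n"
  let ?O = "range (sync_solution \<omega> \<mu> \<phi> :: real \<Rightarrow> real^2^'n)"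
  let ?N = "sqrt (real CARD('n))"
  define \<eta> where "\<eta> = ?N * sqrt \<mu>"
  have N: "?N > 0" by simp
  have \<eta>: "\<eta> > 0" using assms by (simp add: \<eta>_def)
  have E: "\<exists>X. X 0 = sync_embedding p \<and> solves_on ?f X {0..}" for p
    using flow_denominator_ge_1 assms(1)
    by (intro exI[of _ "\<lambda>t. sync_embedding (planar_flow \<omega> \<mu> p t)"] conjI sync_embedding_flow_solves)
      (auto simp: planar_flow_0 intro: less_le_trans[OF zero_less_one])
  have est: "infdist (X t) ?O \<le> 3 * infdist (sync_embedding p) ?O / flow_denominator \<mu> (norm p) t"
    if "X 0 = sync_embedding p" "solves_on ?f X {0..}" "t \<ge> 0"
      "infdist (sync_embedding p) ?O < \<eta>" for X p t
  proof -
    have r: "\<bar>norm p - sqrt \<mu>\<bar> < sqrt \<mu>"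
      using that(4) N unfolding infdist_sync_orbit[OF assms(2,1)] \<eta>_def
      by (simp only: mult_less_cancel_left_pos)
    have "(norm p)\<^sup>2 - \<mu> = (norm p - sqrt \<mu>) * (norm p + sqrt \<mu>)"
      using assms(1) by (simp add: power2_eq_square algebra_simps)
    then have "\<bar>(norm p)\<^sup>2 - \<mu>\<bar> = \<bar>norm p - sqrt \<mu>\<bar> * (norm p + sqrt \<mu>)"
      using assms(1) by (simp add: abs_mult)
    also have "\<dots> \<le> \<bar>norm p - sqrt \<mu>\<bar> * (3 * sqrt \<mu>)"
      using r by (intro mult_left_mono) auto
    finally have "\<bar>(norm p)\<^sup>2 - \<mu>\<bar> / sqrt \<mu> \<le> 3 * \<bar>norm p - sqrt \<mu>\<bar>"
      using assms(1) by (simp add: field_simps)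
    then have "\<bar>(norm p)\<^sup>2 - \<mu>\<bar> / sqrt \<mu> / flow_denominator \<mu> (norm p) t
        \<le> 3 * \<bar>norm p - sqrt \<mu>\<bar> / flow_denominator \<mu> (norm p) t"
      using flow_denominator_ge_1[OF assms(1) that(3), of "norm p"]
      by (intro divide_right_mono) auto
    then have "\<bar>norm (planar_flow \<omega> \<mu> p t) - sqrt \<mu>\<bar>
        \<le> 3 * \<bar>norm p - sqrt \<mu>\<bar> / flow_denominator \<mu> (norm p) t"
      unfolding norm_planar_flow
      using flow_radius_deviation[OF assms(1) that(3), of "norm p"] by simp
    from mult_left_mono[OF this, of ?N] show ?thesis
      unfolding solution_from_sync_embedding[OF assms(1) that(2,1,3)]
        infdist_sync_orbit[OF assms(2,1)]
      by (simp add: mult_ac)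
  qed
  have sub: "?O \<subseteq> sync_manifold"
    by (auto simp: sync_manifold_eq_range sync_solution_eq_circle)
  have stab: "\<exists>\<delta>>0. \<forall>x\<in>sync_manifold. infdist x ?O < \<delta> \<longrightarrow>
        (\<exists>X. X 0 = x \<and> solves_on ?f X {0..}) \<and>
        (\<forall>X. X 0 = x \<and> solves_on ?f X {0..} \<longrightarrow>
           (\<forall>t\<ge>0. X t \<in> sync_manifold \<and> infdist (X t) ?O < \<epsilon>))" if "\<epsilon> > 0" for \<epsilon>
  proof (intro exI[of _ "min \<eta> (\<epsilon> / 3)"] conjI ballI impI allI)
    show "0 < min \<eta> (\<epsilon> / 3)" using \<eta> that by simp
  next
    fix x :: "real^2^'n"
    assume x: "x \<in> sync_manifold" "infdist x ?O < min \<eta> (\<epsilon> / 3)"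
    then obtain p where p: "x = sync_embedding p" by (auto simp: sync_manifold_eq_range)
    show "\<exists>X. X 0 = x \<and> solves_on ?f X {0..}" using E p by blast
    fix X and t :: real
    assume X: "X 0 = x \<and> solves_on ?f X {0..}" and t: "0 \<le> t"
    show "X t \<in> sync_manifold"
      using solution_from_sync_embedding[of \<mu> \<omega> c a X p t] X t p assms(1)
      by (simp add: sync_manifold_eq_range)
    have "infdist (X t) ?O \<le> 3 * infdist x ?O / flow_denominator \<mu> (norm p) t"
      using est[of X p t] X t x p by simp
    also have "\<dots> \<le> 3 * infdist x ?O / 1"
      using flow_denominator_ge_1[OF assms(1) t, of "norm p"] infdist_nonneg[of x ?O]
      by (intro divide_left_mono) auto
    finally show "infdist (X t) ?O < \<epsilon>" using x by simp
  qed
  have attr: "\<exists>\<delta>>0. \<forall>x\<in>sync_manifold. infdist x ?O < \<delta> \<longrightarrow>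
        (\<forall>X. X 0 = x \<and> solves_on ?f X {0..} \<longrightarrow> ((\<lambda>t. infdist (X t) ?O) \<longlongrightarrow> 0) at_top)"
  proof (intro exI[of _ \<eta>] conjI ballI impI allI \<eta>)
    fix x :: "real^2^'n" and X
    assume x: "x \<in> sync_manifold" "infdist x ?O < \<eta>" and X: "X 0 = x \<and> solves_on ?f X {0..}"
    then obtain p where p: "x = sync_embedding p" by (auto simp: sync_manifold_eq_range)
    have "\<bar>norm p - sqrt \<mu>\<bar> < sqrt \<mu>"
      using x(2) N unfolding p infdist_sync_orbit[OF assms(2,1)] \<eta>_def
      by (simp only: mult_less_cancel_left_pos)
    then have "norm p > 0" by linarith
    then have "((\<lambda>t. 3 * infdist x ?O / flow_denominator \<mu> (norm p) t) \<longlongrightarrow> 0) at_top"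
      using flow_denominator_at_top[OF assms(1)]
      by (intro real_tendsto_divide_at_top[OF tendsto_const]) auto
    then show "((\<lambda>t. infdist (X t) ?O) \<longlongrightarrow> 0) at_top"
    proof (rule tendsto_sandwich[rotated 2, OF tendsto_const])
      show "\<forall>\<^sub>F t in at_top. 0 \<le> infdist (X t) ?O" by (simp add: infdist_nonneg)
      show "\<forall>\<^sub>F t in at_top. infdist (X t) ?O
          \<le> 3 * infdist x ?O / flow_denominator \<mu> (norm p) t"
        using eventually_ge_at_top[of 0] by eventually_elim (use est X x p in auto)
    qed
  qed
  show ?thesis
    unfolding orbitally_asymptotically_stable_rel_def using sub stab attr by blast
qed

theorem theorem4p1:
  fixes c \<omega> :: real and s :: nat and node :: "'n::finite \<Rightarrow> nat"
  assumes "c > 0" and "\<omega> \<noteq> 0"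
    and "bij_betw node UNIV {1..CARD('n)}"
    and "1 \<le> s"
    and "even CARD('n) \<Longrightarrow> real s \<le> real CARD('n) / 2"
    and "odd CARD('n) \<Longrightarrow> real s \<le> (real CARD('n) - 1) / 2"
  shows "supercritical_Hopf (planar_field \<omega>) \<omega> \<and>
    (\<forall>\<^sub>F \<mu> in at_right 0. \<forall>\<phi>\<^sub>0.
       periodic_solution
         (network_field \<omega> c (\<lambda>l k. ring_coupling CARD('n) s (node l) (node k)) \<mu>)
         (sync_solution \<omega> \<mu> \<phi>\<^sub>0 :: real \<Rightarrow> real^2^'n) \<and>
       orbitally_asymptotically_stable_rel
         (network_field \<omega> c (\<lambda>l k. ring_coupling CARD('n) s (node l) (node k)) \<mu>)
         sync_manifold
         (sync_solution \<omega> \<mu> \<phi>\<^sub>0 :: real \<Rightarrow> real^2^'n))"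
proof (intro conjI)
  show "supercritical_Hopf (planar_field \<omega>) \<omega>"
    using assms(2) by (rule planar_supercritical_Hopf)
  show "\<forall>\<^sub>F \<mu> in at_right 0. \<forall>\<phi>\<^sub>0.
       periodic_solution
         (network_field \<omega> c (\<lambda>l k. ring_coupling CARD('n) s (node l) (node k)) \<mu>)
         (sync_solution \<omega> \<mu> \<phi>\<^sub>0 :: real \<Rightarrow> real^2^'n) \<and>
       orbitally_asymptotically_stable_rel
         (network_field \<omega> c (\<lambda>l k. ring_coupling CARD('n) s (node l) (node k)) \<mu>)
         sync_manifold
         (sync_solution \<omega> \<mu> \<phi>\<^sub>0 :: real \<Rightarrow> real^2^'n)"
    using eventually_at_right_less[of 0]
    by eventually_elim (use assms(2) sync_solution_periodic sync_solution_stable in blast)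
qed

end
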